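(* Let $X = \{(x,y,z,w)\in\mathbb{C}^4 : x^2y + x + z^2 + w^3 = 0\}$ be the Koras--Russell cubic threefold. Then the bracket width of the Lie algebra $\operatorname{Vec}(X)$ is at most $7$.
   Context: $\operatorname{Vec}(X)$ denotes the Lie algebra over $\mathbb{C}$ of (polynomial) vector fields on the affine variety $X$, i.e. the $\mathbb{C}$-linear derivations of the coordinate ring $\mathbb{C}[X]=\mathbb{C}[x,y,z,w]/(x^2y+x+z^2+w^3)$, with the commutator bracket. For a Lie algebra $L$ and $\zeta \in [L,L]$ (the derived algebra), let $\ell(\zeta)$ be the smallest number $m$ such that $\zeta = \sum_{i=1}^m [u_i,v_i]$ for some $u_i,v_i \in L$. The bracket width of $L$ is $\sup\{\ell(\zeta) : \zeta \in [L,L]\}$. *)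

theory Defs
  imports
    "HOL-Computational_Algebra.Polynomial"
    "HOL-Library.Extended_Nat"
    "HOL-Library.Function_Algebras"
begin

section \<open>Bracket width of a Lie algebra\<close>

text \<open>A Lie algebra over a field, carried by a subspace \<open>L\<close> of an ambient vector space.\<close>

locale lie_algebra = vector_space scale
  for scale :: "'k::field \<Rightarrow> 'v::ab_group_add \<Rightarrow> 'v" +
  fixes L :: "'v set" and bracket :: "'v \<Rightarrow> 'v \<Rightarrow> 'v"
  assumes subspace_carrier: "subspace L"
    and bracket_closed: "\<lbrakk>u \<in> L; v \<in> L\<rbrakk> \<Longrightarrow> bracket u v \<in> L"
    and bracket_add_left:
      "\<lbrakk>u \<in> L; u' \<in> L; v \<in> L\<rbrakk> \<Longrightarrow> bracket (u + u') v = bracket u v + bracket u' v"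
    and bracket_add_right:
      "\<lbrakk>u \<in> L; v \<in> L; v' \<in> L\<rbrakk> \<Longrightarrow> bracket u (v + v') = bracket u v + bracket u v'"
    and bracket_scale_left:
      "\<lbrakk>u \<in> L; v \<in> L\<rbrakk> \<Longrightarrow> bracket (scale c u) v = scale c (bracket u v)"
    and bracket_scale_right:
      "\<lbrakk>u \<in> L; v \<in> L\<rbrakk> \<Longrightarrow> bracket u (scale c v) = scale c (bracket u v)"
    and bracket_self: "u \<in> L \<Longrightarrow> bracket u u = 0"
    and jacobi: "\<lbrakk>u \<in> L; v \<in> L; t \<in> L\<rbrakk> \<Longrightarrow>
      bracket u (bracket v t) + bracket v (bracket t u) + bracket t (bracket u v) = 0"
begin

definition derived_algebra :: "'v set"
  where "derived_algebra = span {bracket u v | u v. u \<in> L \<and> v \<in> L}"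

definition is_bracket_sum :: "nat \<Rightarrow> 'v \<Rightarrow> bool"
  where "is_bracket_sum m \<zeta> \<longleftrightarrow>
    (\<exists>u v. (\<forall>i<m. u i \<in> L \<and> v i \<in> L) \<and> \<zeta> = (\<Sum>i<m. bracket (u i) (v i)))"

definition bracket_length :: "'v \<Rightarrow> nat"
  where "bracket_length \<zeta> = (LEAST m. is_bracket_sum m \<zeta>)"

definition bracket_width :: enat
  where "bracket_width = (SUP \<zeta>\<in>derived_algebra. enat (bracket_length \<zeta>))"

text \<open>The \<open>LEAST\<close> above is attained for every element of the derived algebra.\<close>

lemma derived_algebra_is_bracket_sum:
  assumes "\<zeta> \<in> derived_algebra"
  shows "\<exists>m. is_bracket_sum m \<zeta>"
  using assms unfolding derived_algebra_def
proof (induction rule: span_induct_alt)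
  case base
  have "is_bracket_sum 0 0" by (simp add: is_bracket_sum_def)
  then show ?case by blast
next
  case (step c b \<eta>)
  from step(1) obtain p q where pq: "p \<in> L" "q \<in> L" "b = bracket p q" by blast
  from step(2) obtain u v and m :: nat where m: "\<forall>i<m. u i \<in> L \<and> v i \<in> L"
      "\<eta> = (\<Sum>i<m. bracket (u i) (v i))"
    unfolding is_bracket_sum_def by blast
  have "scale c p \<in> L" using subspace_carrier pq(1) by (rule subspace_scale)
  moreover have "scale c b + \<eta> =
      (\<Sum>i<Suc m. bracket ((u(m := scale c p)) i) ((v(m := q)) i))"
    using pq m by (simp add: bracket_scale_left add.commute)
  ultimately have "is_bracket_sum (Suc m) (scale c b + \<eta>)"
    unfolding is_bracket_sum_def using pq m
    by (intro exI[of _ "u(m := scale c p)"] exI[of _ "v(m := q)"]) (auto simp: less_Suc_eq)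
  then show ?case by blast
qed

end

section \<open>The coordinate ring of the Koras--Russell cubic\<close>

text \<open>The polynomial ring in four variables is the iterated polynomial ring
  \<open>\<complex>[x][y][z][w]\<close>: the outermost variable is \<open>w\<close>, the innermost one \<open>x\<close>.\<close>

type_synonym poly4 = "complex poly poly poly poly"

definition var_x :: poly4 where "var_x = [:[:[:[:0, 1:]:]:]:]"
definition var_y :: poly4 where "var_y = [:[:[:0, 1:]:]:]"
definition var_z :: poly4 where "var_z = [:[:0, 1:]:]"
definition var_w :: poly4 where "var_w = [:0, 1:]"

definition const4 :: "complex \<Rightarrow> poly4" where "const4 c = [:[:[:[:c:]:]:]:]"

definition kr_poly :: poly4
  where "kr_poly = var_x ^ 2 * var_y + var_x + var_z ^ 2 + var_w ^ 3"

definition kr_cong :: "poly4 \<Rightarrow> poly4 \<Rightarrow> bool"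
  where "kr_cong f g \<longleftrightarrow> kr_poly dvd (f - g)"

quotient_type kr_ring = poly4 / kr_cong
proof (rule equivpI)
  show "reflp kr_cong" by (simp add: reflp_def kr_cong_def)
  show "symp kr_cong" unfolding symp_def kr_cong_def by (metis dvd_minus_iff minus_diff_eq)
  show "transp kr_cong"
  proof (rule transpI)
    fix f g h assume "kr_cong f g" "kr_cong g h"
    then have "kr_poly dvd (f - g) + (g - h)" unfolding kr_cong_def by (rule dvd_add)
    then show "kr_cong f h" by (simp add: kr_cong_def)
  qed
qed

instantiation kr_ring :: comm_ring_1
begin

lift_definition zero_kr_ring :: kr_ring is 0 .
lift_definition one_kr_ring :: kr_ring is 1 .

lift_definition plus_kr_ring :: "kr_ring \<Rightarrow> kr_ring \<Rightarrow> kr_ring" is "(+)"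
proof -
  fix f f' g g' :: poly4
  assume "kr_cong f f'" "kr_cong g g'"
  then have "kr_poly dvd (f - f') + (g - g')" unfolding kr_cong_def by (rule dvd_add)
  then show "kr_cong (f + g) (f' + g')" by (simp add: kr_cong_def algebra_simps)
qed

lift_definition uminus_kr_ring :: "kr_ring \<Rightarrow> kr_ring" is uminus
  unfolding kr_cong_def by (metis dvd_minus_iff minus_diff_minus)

lift_definition minus_kr_ring :: "kr_ring \<Rightarrow> kr_ring \<Rightarrow> kr_ring" is "(-)"
proof -
  fix f f' g g' :: poly4
  assume "kr_cong f f'" "kr_cong g g'"
  then have "kr_poly dvd (f - f') - (g - g')" unfolding kr_cong_def by (rule dvd_diff)
  then show "kr_cong (f - g) (f' - g')" by (simp add: kr_cong_def algebra_simps)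
qed

lift_definition times_kr_ring :: "kr_ring \<Rightarrow> kr_ring \<Rightarrow> kr_ring" is "(*)"
proof -
  fix f f' g g' :: poly4
  assume "kr_cong f f'" "kr_cong g g'"
  then have "kr_poly dvd (f - f') * g + f' * (g - g')" unfolding kr_cong_def by simp
  then show "kr_cong (f * g) (f' * g')" by (simp add: kr_cong_def algebra_simps)
qed

instance
proof
  show "(0::kr_ring) \<noteq> 1"
  proof (transfer, unfold kr_cong_def, rule notI)
    assume "kr_poly dvd 0 - 1"
    then have "kr_poly dvd 1" by simp
    then have "degree kr_poly = 0" by (metis degree_pCons_0 is_unit_poly_iff)
    then show False
      by (simp add: kr_poly_def var_x_def var_y_def var_z_def var_w_def power2_eq_square power3_eq_cube)
  qed
qed (transfer; simp add: kr_cong_def algebra_simps)+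

end

lift_definition kr_const :: "complex \<Rightarrow> kr_ring" is const4 .

section \<open>Vector fields on the Koras--Russell cubic\<close>

definition scale_field :: "complex \<Rightarrow> (kr_ring \<Rightarrow> kr_ring) \<Rightarrow> kr_ring \<Rightarrow> kr_ring"
  where "scale_field c D = (\<lambda>f. kr_const c * D f)"

definition commutator :: "(kr_ring \<Rightarrow> kr_ring) \<Rightarrow> (kr_ring \<Rightarrow> kr_ring) \<Rightarrow> kr_ring \<Rightarrow> kr_ring"
  where "commutator D E = (\<lambda>f. D (E f) - E (D f))"

definition kr_Vec :: "(kr_ring \<Rightarrow> kr_ring) set"
  where "kr_Vec = {D.
    (\<forall>f g. D (f + g) = D f + D g) \<and>
    (\<forall>c f. D (kr_const c * f) = kr_const c * D f) \<and>
    (\<forall>f g. D (f * g) = f * D g + D f * g)}"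

lemma kr_const_add: "kr_const (a + b) = kr_const a + kr_const b"
  by transfer (simp add: kr_cong_def const4_def)

lemma kr_const_mult: "kr_const (a * b) = kr_const a * kr_const b"
  by transfer (simp add: kr_cong_def const4_def)

lemma kr_const_1: "kr_const 1 = 1"
  by transfer (simp add: kr_cong_def const4_def one_pCons)

lemma vector_space_scale_field: "vector_space scale_field"
  by unfold_locales
    (simp_all add: scale_field_def fun_eq_iff kr_const_add kr_const_mult kr_const_1 algebra_simps)

lemma kr_VecD:
  assumes "D \<in> kr_Vec"
  shows "D (f + g) = D f + D g"
    and "D (kr_const c * f) = kr_const c * D f"
    and "D (f * g) = f * D g + D f * g"
  using assms unfolding kr_Vec_def by blast+

lemma kr_Vec_diff:
  assumes "D \<in> kr_Vec"
  shows "D (f - g) = D f - D g"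
  using kr_VecD(1)[OF assms, of "f - g" g] by (simp add: algebra_simps)

lemma lie_algebra_kr_Vec: "lie_algebra scale_field kr_Vec commutator"
proof -
  interpret vector_space scale_field by (rule vector_space_scale_field)
  show ?thesis
  proof
    show "subspace kr_Vec"
      by (auto simp: subspace_def kr_Vec_def scale_field_def algebra_simps)
    show "commutator u v \<in> kr_Vec" if "u \<in> kr_Vec" "v \<in> kr_Vec" for u v
    proof -
      note D = kr_VecD[OF that(1)] kr_VecD[OF that(2)]
      show ?thesis
        unfolding kr_Vec_def commutator_def mem_Collect_eq
        by (intro conjI allI) (simp_all only: D(1,4) D(2,5), simp_all add: D algebra_simps)
    qed
  qed (auto simp: commutator_def scale_field_def fun_eq_iff kr_Vec_diff kr_VecD(1,2)
      right_diff_distrib)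
qed

end

theory Submission imports Defs begin

text \<open>With \<open>p = 2xy + 1\<close>, the identity \<open>(1 - 2xy) p + 4y\<^sup>2 x\<^sup>2 = 1\<close> shows that \<open>Vec(X)\<close> is free with
  basis \<open>Y = p \<partial>\<^sub>y - x\<^sup>2 \<partial>\<^sub>x\<close> and two fields \<open>Z\<close>, \<open>W\<close> such that \<open>Z z = W w = 1\<close> and
  \<open>Z w = W z = 0\<close>. For any field \<open>\<mu>\<close>,
  \<open>f \<mu>(g) \<mu> = [\<mu>, g f \<mu> / 2] - [g \<mu> / 2, f \<mu>]\<close>, so if \<open>h\<close> is a combination of
  \<open>\<mu>(g\<^sub>1), \<dots>, \<mu>(g\<^sub>n)\<close> then \<open>h \<mu>\<close> is a sum of \<open>n + 1\<close> brackets. One function suffices for each of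
  \<open>Z\<close> and \<open>W\<close> (namely \<open>z\<close>, \<open>w\<close>) and two for \<open>Y\<close> (namely \<open>x\<close>, \<open>y\<close>), which gives
  \<open>2 + 2 + 3 = 7\<close>.\<close>

section \<open>Bracket sums\<close>

context lie_algebra
begin

lemma is_bracket_sum_single:
  assumes "u \<in> L" "v \<in> L"
  shows "is_bracket_sum 1 (bracket u v)"
  unfolding is_bracket_sum_def
  using assms by (intro exI[of _ "\<lambda>_. u"] exI[of _ "\<lambda>_. v"]) simp

lemma is_bracket_sum_add:
  assumes "is_bracket_sum m a" "is_bracket_sum n b"
  shows "is_bracket_sum (m + n) (a + b)"
proof -
  obtain u v where uv: "\<forall>i<m. u i \<in> L \<and> v i \<in> L" "a = (\<Sum>i<m. bracket (u i) (v i))"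
    using assms(1) unfolding is_bracket_sum_def by blast
  obtain u' v' where uv': "\<forall>i<n. u' i \<in> L \<and> v' i \<in> L" "b = (\<Sum>i<n. bracket (u' i) (v' i))"
    using assms(2) unfolding is_bracket_sum_def by blast
  define U where "U i = (if i < m then u i else u' (i - m))" for i
  define V where "V i = (if i < m then v i else v' (i - m))" for i
  have "a + b = (\<Sum>i<m + n. bracket (U i) (V i))"
    by (simp add: lessThan_atLeast0 sum.atLeastLessThan_concat[of 0 m "m + n", symmetric]
        sum.shift_bounds_nat_ivl[of _ 0 m n, simplified add.commute[of n m], simplified]
        uv(2) uv'(2) U_def V_def)
  moreover have "\<forall>i<m + n. U i \<in> L \<and> V i \<in> L"
    using uv(1) uv'(1) by (auto simp: U_def V_def)
  ultimately show ?thesis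
    unfolding is_bracket_sum_def by blast
qed

lemma derived_algebra_subset: "derived_algebra \<subseteq> L"
  unfolding derived_algebra_def
  by (rule span_minimal) (auto intro: bracket_closed subspace_carrier)

text \<open>The hypothesis ranges over all of \<open>L\<close>, which contains the derived algebra:
  on this threefold every vector field is a short bracket sum, so membership in the derived algebra
  never has to be analysed.\<close>

lemma bracket_width_leI:
  assumes "\<And>\<zeta>. \<zeta> \<in> L \<Longrightarrow> is_bracket_sum n \<zeta>"
  shows "bracket_width \<le> enat n"
  unfolding bracket_width_def bracket_length_def
  using assms derived_algebra_subset by (intro SUP_least) (auto intro: Least_le)

end

section \<open>Derivations of polynomial rings\<close>

text \<open>Scalars are left out so that one notion serves every layer of the iterated polynomial
  ring; vanishing on constants is tracked separately.\<close>

definition ring_derivation :: "('a::comm_ring_1 \<Rightarrow> 'a) \<Rightarrow> bool"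
  where "ring_derivation d \<longleftrightarrow>
    (\<forall>f g. d (f + g) = d f + d g) \<and> (\<forall>f g. d (f * g) = f * d g + d f * g)"

lemma ring_derivation_0: "ring_derivation d \<Longrightarrow> d 0 = 0"
  unfolding ring_derivation_def by (metis add_cancel_left_left)

lemma ring_derivation_1: "ring_derivation d \<Longrightarrow> d 1 = 0"
  unfolding ring_derivation_def by (metis add_cancel_left_left mult_1 mult_1_right)

lemma ring_derivation_sum:
  assumes "ring_derivation d"
  shows "d (sum f S) = (\<Sum>i\<in>S. d (f i))"
  using assms
  by (induction S rule: infinite_finite_induct)
    (auto simp: ring_derivation_0 ring_derivation_def)

lemma ring_derivation_diff:
  assumes "ring_derivation d"
  shows "d (f - g) = d f - d g"
  using assms unfolding ring_derivation_def by (metis add_diff_cancel diff_add_cancel)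

lemma ring_derivation_power2:
  assumes "ring_derivation d"
  shows "d (f ^ 2) = 2 * f * d f"
  using assms unfolding ring_derivation_def by (simp add: power2_eq_square algebra_simps)

lemma ring_derivation_power3:
  assumes "ring_derivation d"
  shows "d (f ^ 3) = 3 * f ^ 2 * d f"
  using assms unfolding ring_derivation_def
  by (simp add: power2_eq_square power3_eq_cube algebra_simps)

lemma ring_derivation_pderiv: "ring_derivation (pderiv :: 'a::idom poly \<Rightarrow> _)"
  by (simp add: ring_derivation_def pderiv_add pderiv_mult mult.commute)

text \<open>Coefficients of a product are convolutions, and the Leibniz rule applies to each term of
  a convolution. This lifts the derivative in an inner variable through the outer ones.\<close>

lemma ring_derivation_map_poly:
  assumes "ring_derivation d"
  shows "ring_derivation (map_poly d)"
proof -
  note d0 = ring_derivation_0[OF assms]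
  have "map_poly d (f + g) = map_poly d f + map_poly d g" for f g
    using assms by (intro poly_eqI) (simp add: coeff_map_poly d0 ring_derivation_def)
  moreover have "map_poly d (f * g) = f * map_poly d g + map_poly d f * g" for f g
    using assms
    by (intro poly_eqI)
      (simp add: coeff_map_poly d0 coeff_mult ring_derivation_sum sum.distrib,
       simp add: ring_derivation_def sum.distrib)
  ultimately show ?thesis
    unfolding ring_derivation_def by blast
qed

lemma ring_derivation_lincomb:
  assumes "ring_derivation d" "ring_derivation e"
  shows "ring_derivation (\<lambda>f. a * d f + b * e f)"
  using assms unfolding ring_derivation_def by (simp add: algebra_simps)

lemma poly4_derivation_exists:
  fixes a b c d :: poly4
  obtains F where "ring_derivation F" "\<And>k. F (const4 k) = 0"
    "F var_x = a" "F var_y = b" "F var_z = c" "F var_w = d"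
proof -
  \<comment> \<open>The innermost variable \<open>x\<close> lies under three polynomial layers,
    hence three nested \<open>map_poly\<close>; each further variable needs one fewer.\<close>
  define dx :: "poly4 \<Rightarrow> poly4" where "dx = map_poly (map_poly (map_poly pderiv))"
  define dy :: "poly4 \<Rightarrow> poly4" where "dy = map_poly (map_poly pderiv)"
  define dz :: "poly4 \<Rightarrow> poly4" where "dz = map_poly pderiv"
  define dw :: "poly4 \<Rightarrow> poly4" where "dw = pderiv"
  note defs = dx_def dy_def dz_def dw_def
  \<comment> \<open>The factors 1 give the outer sum the shape of
    \<open>ring_derivation_lincomb\<close>.\<close>
  define F where "F = (\<lambda>f. 1 * (a * dx f + b * dy f) + 1 * (c * dz f + d * dw f))"
  show thesis
  proof
    show "ring_derivation F"
      unfolding F_def defs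
      by (intro ring_derivation_lincomb ring_derivation_map_poly ring_derivation_pderiv)
  qed (simp_all add: F_def defs const4_def var_x_def var_y_def var_z_def var_w_def
      map_poly_pCons map_poly_1 pderiv_pCons,
      simp_all flip: one_pCons)
qed

section \<open>Vector fields on the Koras--Russell cubic\<close>

lift_definition kr_x :: kr_ring is var_x .
lift_definition kr_y :: kr_ring is var_y .
lift_definition kr_z :: kr_ring is var_z .
lift_definition kr_w :: kr_ring is var_w .

lemma kr_relation: "kr_x ^ 2 * kr_y + kr_x + kr_z ^ 2 + kr_w ^ 3 = 0"
  unfolding power2_eq_square power3_eq_cube
  by transfer (simp add: kr_cong_def kr_poly_def power2_eq_square power3_eq_cube)

text \<open>The constants and the four coordinates generate the ring, so derivations that kill
  constants can be compared on the coordinates alone.\<close>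

lemma kr_ring_induct [case_names const x y z w add mult]:
  assumes const: "\<And>c. Q (kr_const c)"
    and x: "Q kr_x" and y: "Q kr_y" and z: "Q kr_z" and w: "Q kr_w"
    and add: "\<And>f g. Q f \<Longrightarrow> Q g \<Longrightarrow> Q (f + g)"
    and mult: "\<And>f g. Q f \<Longrightarrow> Q g \<Longrightarrow> Q (f * g)"
  shows "Q f"
proof -
  define R where "R p = Q (abs_kr_ring p)" for p
  have R_add: "R p \<Longrightarrow> R q \<Longrightarrow> R (p + q)" for p q
    unfolding R_def plus_kr_ring.abs_eq[symmetric] by (rule add)
  have R_mult: "R p \<Longrightarrow> R q \<Longrightarrow> R (p * q)" for p q
    unfolding R_def times_kr_ring.abs_eq[symmetric] by (rule mult)
  have R_const: "R [:[:[:[:c:]:]:]:]" for c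
    using const[of c] by (simp add: R_def kr_const.abs_eq const4_def)
  have R_0: "R 0"
    using R_const[of 0] by simp
  \<comment> \<open>The variables are adjoined from the innermost outwards; at each layer
    \<open>pCons c p\<close> is \<open>c\<close> plus the variable times \<open>p\<close>, with
    \<open>c\<close> handled by the previous layer.\<close>
  have R_x: "R [:[:[:p:]:]:]" for p
  proof (induction p)
    case (pCons c p)
    have "[:[:[:pCons c p:]:]:] = [:[:[:[:c:]:]:]:] + var_x * [:[:[:p:]:]:]"
      by (simp add: var_x_def)
    then show ?case
      using R_add[OF R_const[of c] R_mult[OF _ pCons.IH]] x by (simp add: R_def kr_x_def)
  qed (simp add: R_0)
  have R_y: "R [:[:p:]:]" for p
  proof (induction p)
    case (pCons c p)
    have "[:[:pCons c p:]:] = [:[:[:c:]:]:] + var_y * [:[:p:]:]"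
      by (simp add: var_y_def)
    then show ?case
      using R_add[OF R_x[of c] R_mult[OF _ pCons.IH]] y by (simp add: R_def kr_y_def)
  qed (simp add: R_0)
  have R_z: "R [:p:]" for p
  proof (induction p)
    case (pCons c p)
    have "[:pCons c p:] = [:[:c:]:] + var_z * [:p:]"
      by (simp add: var_z_def)
    then show ?case
      using R_add[OF R_y[of c] R_mult[OF _ pCons.IH]] z by (simp add: R_def kr_z_def)
  qed (simp add: R_0)
  have "R p" for p
  proof (induction p)
    case (pCons c p)
    have "pCons c p = [:c:] + var_w * p"
      by (simp add: var_w_def)
    then show ?case
      using R_add[OF R_z[of c] R_mult[OF _ pCons.IH]] w by (simp add: R_def kr_w_def)
  qed (simp add: R_0)
  then show ?thesis
    unfolding R_def by (metis Quotient3_abs_rep Quotient3_kr_ring)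
qed

section \<open>Vector fields as solutions of one linear equation\<close>

lemma kr_Vec_ring_derivation: "D \<in> kr_Vec \<Longrightarrow> ring_derivation D"
  by (simp add: kr_Vec_def ring_derivation_def)

lemma kr_Vec_const: "D \<in> kr_Vec \<Longrightarrow> D (kr_const c) = 0"
  using kr_VecD(2)[of D c 1] ring_derivation_1[OF kr_Vec_ring_derivation, of D] by simp

lemma kr_Vec_scale:
  assumes "D \<in> kr_Vec"
  shows "(\<lambda>f. a * D f) \<in> kr_Vec"
  unfolding kr_Vec_def by (simp add: kr_VecD[OF assms] kr_Vec_const[OF assms] algebra_simps)

lemma kr_Vec_add:
  assumes "D \<in> kr_Vec" "E \<in> kr_Vec"
  shows "D + E \<in> kr_Vec"
  unfolding kr_Vec_def
  by (simp add: kr_VecD[OF assms(1)] kr_VecD[OF assms(2)] kr_Vec_const[OF assms(1)]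
      kr_Vec_const[OF assms(2)] algebra_simps)

lemma kr_Vec_eqI:
  assumes D: "D \<in> kr_Vec" and E: "E \<in> kr_Vec"
    and "D kr_x = E kr_x" "D kr_y = E kr_y" "D kr_z = E kr_z" "D kr_w = E kr_w"
  shows "D = E"
proof
  fix f show "D f = E f"
    by (induction f rule: kr_ring_induct)
      (use assms in \<open>simp_all add: kr_Vec_const kr_VecD(1)[OF D] kr_VecD(1)[OF E]
        kr_VecD(3)[OF D] kr_VecD(3)[OF E]\<close>)
qed

text \<open>Applying \<open>D\<close> to the defining equation gives this; the coefficients are the
  partial derivatives of \<open>kr_poly\<close>.\<close>

lemma kr_Vec_relation:
  assumes "D \<in> kr_Vec"
  shows "(2 * kr_x * kr_y + 1) * D kr_x + kr_x ^ 2 * D kr_y + 2 * kr_z * D kr_z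
    + 3 * kr_w ^ 2 * D kr_w = 0"
proof -
  note d = kr_Vec_ring_derivation[OF assms]
  have "D (kr_x ^ 2 * kr_y + kr_x + kr_z ^ 2 + kr_w ^ 3) = 0"
    by (simp add: kr_relation ring_derivation_0[OF d])
  then show ?thesis
    by (simp add: kr_VecD(1,3)[OF assms] ring_derivation_power2[OF d]
        ring_derivation_power3[OF d] algebra_simps)
qed

text \<open>Converse of \<open>kr_Vec_relation\<close>: lift the values to polynomials, take the
  polynomial derivation with these values, and descend to the quotient, which works because that
  derivation preserves the ideal of \<open>kr_poly\<close>.\<close>

lemma kr_Vec_exists:
  fixes a b c d :: kr_ring
  assumes "(2 * kr_x * kr_y + 1) * a + kr_x ^ 2 * b + 2 * kr_z * c + 3 * kr_w ^ 2 * d = 0"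
  obtains D where "D \<in> kr_Vec" "D kr_x = a" "D kr_y = b" "D kr_z = c" "D kr_w = d"
proof -
  obtain a' b' c' d' where reps: "a = abs_kr_ring a'" "b = abs_kr_ring b'"
      "c = abs_kr_ring c'" "d = abs_kr_ring d'"
    by (metis Quotient3_abs_rep Quotient3_kr_ring)
  obtain F where F: "ring_derivation F" "\<And>k. F (const4 k) = 0"
    "F var_x = a'" "F var_y = b'" "F var_z = c'" "F var_w = d'"
    using poly4_derivation_exists by blast
  have F_add: "F (f + g) = F f + F g" and F_mult: "F (f * g) = f * F g + F f * g" for f g
    using F(1) by (auto simp: ring_derivation_def)
  have two: "abs_kr_ring 2 = 2"
    using plus_kr_ring.abs_eq[of 1 1] by (simp flip: one_kr_ring.abs_eq)
  have three: "abs_kr_ring 3 = 3"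
    using plus_kr_ring.abs_eq[of 1 2] by (simp add: two flip: one_kr_ring.abs_eq)
  \<comment> \<open>The chain rule turns the class of \<open>F kr_poly\<close> into the left side of
    the assumption.\<close>
  have "abs_kr_ring (F kr_poly) = 0"
    using assms
    by (simp add: kr_poly_def F_add F_mult ring_derivation_power2[OF F(1)]
        ring_derivation_power3[OF F(1)] F reps kr_x_def kr_y_def kr_z_def kr_w_def
        power2_eq_square two three algebra_simps
        flip: plus_kr_ring.abs_eq times_kr_ring.abs_eq)
  then have dvd: "kr_poly dvd F kr_poly"
    by (simp add: zero_kr_ring_def kr_ring.abs_eq_iff kr_cong_def)
  have F_cong: "kr_cong (F f) (F g)" if fg: "kr_cong f g" for f g
  proof -
    obtain k where "f - g = kr_poly * k"
      using fg unfolding kr_cong_def by (elim dvdE)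
    \<comment> \<open>By Leibniz, divisibility of \<open>F kr_poly\<close> alone makes
      \<open>F\<close> respect the congruence.\<close>
    then have "F f - F g = kr_poly * F k + F kr_poly * k"
      by (simp add: F_mult flip: ring_derivation_diff[OF F(1)])
    then show ?thesis
      unfolding kr_cong_def using dvd by (metis dvd_add dvd_mult2 dvd_triv_left)
  qed
  define D where "D = map_fun rep_kr_ring abs_kr_ring F"
  have D: "D (abs_kr_ring f) = abs_kr_ring (F f)" for f
  proof -
    have "kr_cong (rep_kr_ring (abs_kr_ring f)) f"
      by (metis Quotient3_abs_rep Quotient3_kr_ring kr_ring.abs_eq_iff)
    then show ?thesis
      using F_cong by (simp add: D_def kr_ring.abs_eq_iff)
  qed
  have "D \<in> kr_Vec"
    unfolding kr_Vec_def mem_Collect_eq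
  proof (intro conjI allI)
    show "D (f + g) = D f + D g" for f g
      by (induction f rule: kr_ring.abs_induct, induction g rule: kr_ring.abs_induct)
        (simp add: plus_kr_ring.abs_eq D F_add)
    show D_mult: "D (f * g) = f * D g + D f * g" for f g
      by (induction f rule: kr_ring.abs_induct, induction g rule: kr_ring.abs_induct)
        (simp add: plus_kr_ring.abs_eq times_kr_ring.abs_eq D F_mult)
    show "D (kr_const k * f) = kr_const k * D f" for k f
      by (simp add: D_mult kr_const.abs_eq D F(2) flip: zero_kr_ring_def)
  qed
  then show thesis
    by (rule that) (simp_all add: kr_x_def kr_y_def kr_z_def kr_w_def D F reps)
qed

section \<open>Multiples of one field as bracket sums\<close>

interpretation kr: lie_algebra scale_field kr_Vec commutator
  by (rule lie_algebra_kr_Vec)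

text \<open>The second-order terms \<open>a * b * \<mu> (\<mu> t)\<close> cancel.\<close>

lemma commutator_multiples:
  assumes "\<mu> \<in> kr_Vec"
  shows "commutator (\<lambda>t. a * \<mu> t) (\<lambda>t. b * \<mu> t) = (\<lambda>t. (a * \<mu> b - b * \<mu> a) * \<mu> t)"
  unfolding commutator_def by (simp add: kr_VecD(3)[OF assms] algebra_simps)

lemma sum_fun_apply: "(\<Sum>i\<in>S. F i) t = (\<Sum>i\<in>S. F i t)"
  by (induction S rule: infinite_finite_induct) auto

lemma kr_is_bracket_sum_multiple:
  assumes \<mu>: "\<mu> \<in> kr_Vec" and h: "h = (\<Sum>i<n. f i * \<mu> (g i))"
  shows "kr.is_bracket_sum (Suc n) (\<lambda>t. h * \<mu> t)"
proof -
  define r where "r = kr_const (1/2)"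
  have r: "r + r = 1"
    by (simp add: r_def kr_const_1 flip: kr_const_add)
  have \<mu>_r: "\<mu> (r * t) = r * \<mu> t" for t
    unfolding r_def by (rule kr_VecD(2)[OF \<mu>])
  \<comment> \<open>The brackets \<open>[\<mu>, g f \<mu> / 2]\<close> share their left entry, so
    their sum over \<open>i\<close> is the single bracket of \<open>\<mu>\<close> with
    \<open>k * \<mu>\<close>; this gives \<open>n + 1\<close> brackets instead of
    \<open>2 n\<close>.\<close>
  define k where "k = (\<Sum>i<n. r * (g i * f i))"
  have "kr.is_bracket_sum 1 (commutator (\<lambda>t. 1 * \<mu> t) (\<lambda>t. k * \<mu> t))"
    by (intro kr.is_bracket_sum_single kr_Vec_scale \<mu>)
  moreover have "kr.is_bracket_sum n
      (\<Sum>i<n. commutator (\<lambda>t. (r * f i) * \<mu> t) (\<lambda>t. g i * \<mu> t))"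
    unfolding kr.is_bracket_sum_def using \<mu>
    by (intro exI[of _ "\<lambda>i t. r * f i * \<mu> t"] exI[of _ "\<lambda>i t. g i * \<mu> t"])
      (simp add: kr_Vec_scale)
  ultimately have "kr.is_bracket_sum (1 + n) (commutator (\<lambda>t. 1 * \<mu> t) (\<lambda>t. k * \<mu> t)
      + (\<Sum>i<n. commutator (\<lambda>t. (r * f i) * \<mu> t) (\<lambda>t. g i * \<mu> t)))"
    by (rule kr.is_bracket_sum_add)
  moreover have "commutator (\<lambda>t. 1 * \<mu> t) (\<lambda>t. k * \<mu> t)
      + (\<Sum>i<n. commutator (\<lambda>t. (r * f i) * \<mu> t) (\<lambda>t. g i * \<mu> t)) = (\<lambda>t. h * \<mu> t)"
  proof
    fix t
    \<comment> \<open>In \<open>\<mu> k\<close> the Leibniz rule yields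
      \<open>r * f i * \<mu> (g i)\<close>, which doubles, and \<open>r * g i * \<mu> (f i)\<close>,
      which cancels.\<close>
    have "\<mu> k + (\<Sum>i<n. r * f i * \<mu> (g i) - g i * \<mu> (r * f i))
        = (\<Sum>i<n. (r + r) * (f i * \<mu> (g i)))"
      by (simp add: k_def ring_derivation_sum[OF kr_Vec_ring_derivation[OF \<mu>]] \<mu>_r
          kr_VecD(3)[OF \<mu>] algebra_simps flip: sum.distrib)
    then have "\<mu> k + (\<Sum>i<n. r * f i * \<mu> (g i) - g i * \<mu> (r * f i)) = h"
      by (simp add: r h)
    then show "(commutator (\<lambda>t. 1 * \<mu> t) (\<lambda>t. k * \<mu> t)
      + (\<Sum>i<n. commutator (\<lambda>t. (r * f i) * \<mu> t) (\<lambda>t. g i * \<mu> t))) t = h * \<mu> t"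
      unfolding plus_fun_apply sum_fun_apply commutator_multiples[OF \<mu>]
      by (simp add: ring_derivation_1[OF kr_Vec_ring_derivation[OF \<mu>]]
          flip: sum_distrib_right distrib_right)
  qed
  ultimately show ?thesis
    by (simp only: plus_1_eq_Suc)
qed

section \<open>Three fields generating the module of vector fields\<close>

lemma kr_Vec_basis:
  obtains Y Z W where "Y \<in> kr_Vec" "Z \<in> kr_Vec" "W \<in> kr_Vec"
    "Y kr_x = - (kr_x ^ 2)" "Y kr_y = 2 * kr_x * kr_y + 1" "Z kr_z = 1" "W kr_w = 1"
    "\<And>D. D \<in> kr_Vec \<Longrightarrow> \<exists>h. D = (\<lambda>t. h * Y t) + (\<lambda>t. D kr_z * Z t) + (\<lambda>t. D kr_w * W t)"
proof -
  let ?p = "2 * kr_x * kr_y + 1" and ?\<alpha> = "1 - 2 * kr_x * kr_y" and ?\<beta> = "4 * kr_y ^ 2"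
  have unit: "?\<alpha> * ?p + ?\<beta> * kr_x ^ 2 = 1"
    by (simp add: power2_eq_square algebra_simps)
  \<comment> \<open>\<open>Y\<close> is the obvious syzygy of the coefficients \<open>?p\<close> and
    \<open>kr_x ^ 2\<close> of the linear equation.\<close>
  obtain Y where Y: "Y \<in> kr_Vec" "Y kr_x = - (kr_x ^ 2)" "Y kr_y = ?p" "Y kr_z = 0" "Y kr_w = 0"
    by (rule kr_Vec_exists[of "- (kr_x ^ 2)" ?p 0 0]) (simp add: algebra_simps)
  \<comment> \<open>With \<open>D kr_z = 1\<close> and \<open>D kr_w = 0\<close>, the term
    \<open>2 * kr_z\<close> must be compensated in the first two entries; \<open>unit\<close> does
    this with the pair \<open>?\<alpha>\<close>, \<open>?\<beta>\<close>. \<open>W\<close> arises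
    likewise from \<open>3 * kr_w ^ 2\<close>.\<close>
  obtain Z where Z: "Z \<in> kr_Vec" "Z kr_x = - ?\<alpha> * (2 * kr_z)" "Z kr_y = - ?\<beta> * (2 * kr_z)"
      "Z kr_z = 1" "Z kr_w = 0"
    by (rule kr_Vec_exists[of "- ?\<alpha> * (2 * kr_z)" "- ?\<beta> * (2 * kr_z)" 1 0])
      (simp add: power2_eq_square algebra_simps)
  obtain W where W: "W \<in> kr_Vec" "W kr_x = - ?\<alpha> * (3 * kr_w ^ 2)"
      "W kr_y = - ?\<beta> * (3 * kr_w ^ 2)" "W kr_z = 0" "W kr_w = 1"
    by (rule kr_Vec_exists[of "- ?\<alpha> * (3 * kr_w ^ 2)" "- ?\<beta> * (3 * kr_w ^ 2)" 0 1])
      (simp add: power2_eq_square algebra_simps)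
  show thesis
  proof (rule that[OF Y(1) Z(1) W(1) Y(2,3) Z(4) W(5)])
    fix D assume D: "D \<in> kr_Vec"
    \<comment> \<open>This expression in \<open>D\<close> takes the value 1 on \<open>Y\<close>, by
      \<open>unit\<close>, and 0 on \<open>Z\<close> and \<open>W\<close>, so it reads off the
      coefficient of \<open>Y\<close>.\<close>
    define h where "h = ?\<alpha> * D kr_y - ?\<beta> * D kr_x"
    define E where "E = (\<lambda>t. h * Y t) + (\<lambda>t. D kr_z * Z t) + (\<lambda>t. D kr_w * W t)"
    have rel: "?p * D kr_x + kr_x ^ 2 * D kr_y + 2 * kr_z * D kr_z + 3 * kr_w ^ 2 * D kr_w = 0"
      by (rule kr_Vec_relation[OF D])
    have "D = E"
    proof (rule kr_Vec_eqI[OF D])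
      show "E \<in> kr_Vec"
        unfolding E_def by (intro kr_Vec_add kr_Vec_scale Y Z W)
      \<comment> \<open>The difference is written as a combination of \<open>unit\<close> and
        \<open>rel\<close>, each of which contributes zero.\<close>
      have "D kr_x - E kr_x = D kr_x * (1 - (?\<alpha> * ?p + ?\<beta> * kr_x ^ 2))
          + ?\<alpha> * (?p * D kr_x + kr_x ^ 2 * D kr_y + 2 * kr_z * D kr_z + 3 * kr_w ^ 2 * D kr_w)"
        by (simp add: E_def h_def Y Z W algebra_simps)
      then show "D kr_x = E kr_x"
        unfolding unit rel by simp
      have "D kr_y - E kr_y = D kr_y * (1 - (?\<alpha> * ?p + ?\<beta> * kr_x ^ 2))
          + ?\<beta> * (?p * D kr_x + kr_x ^ 2 * D kr_y + 2 * kr_z * D kr_z + 3 * kr_w ^ 2 * D kr_w)"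
        by (simp add: E_def h_def Y Z W algebra_simps)
      then show "D kr_y = E kr_y"
        unfolding unit rel by simp
    qed (simp_all add: E_def Y Z W)
    then show "\<exists>h. D = (\<lambda>t. h * Y t) + (\<lambda>t. D kr_z * Z t) + (\<lambda>t. D kr_w * W t)"
      unfolding E_def by blast
  qed
qed

theorem mainTheorem4: "lie_algebra.bracket_width scale_field kr_Vec commutator \<le> 7"
proof -
  obtain Y Z W where Y: "Y \<in> kr_Vec" "Y kr_x = - (kr_x ^ 2)" "Y kr_y = 2 * kr_x * kr_y + 1"
    and Z: "Z \<in> kr_Vec" "Z kr_z = 1" and W: "W \<in> kr_Vec" "W kr_w = 1"
    and basis: "\<And>D. D \<in> kr_Vec \<Longrightarrow>
      \<exists>h. D = (\<lambda>t. h * Y t) + (\<lambda>t. D kr_z * Z t) + (\<lambda>t. D kr_w * W t)"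
    using kr_Vec_basis by metis
  have multiple_Y: "kr.is_bracket_sum 3 (\<lambda>t. h * Y t)" for h
  proof -
    \<comment> \<open>These coefficients are \<open>h\<close> times the Bezout identity for
      \<open>?p\<close> and \<open>kr_x ^ 2\<close>; the minus sign offsets that of
      \<open>Y kr_x\<close>.\<close>
    have "h = (\<Sum>i<2. (if i = 0 then - (4 * h * kr_y ^ 2) else h * (1 - 2 * kr_x * kr_y))
        * Y (if i = (0::nat) then kr_x else kr_y))"
      by (simp add: numeral_2_eq_2 Y) (simp add: power2_eq_square algebra_simps)
    from kr_is_bracket_sum_multiple[OF Y(1) this] show ?thesis
      by simp
  qed
  have multiple_Z: "kr.is_bracket_sum 2 (\<lambda>t. h * Z t)" for h
    using kr_is_bracket_sum_multiple[OF Z(1), of h "\<lambda>_. h" "\<lambda>_. kr_z" 1]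
    by (simp add: Z numeral_2_eq_2)
  have multiple_W: "kr.is_bracket_sum 2 (\<lambda>t. h * W t)" for h
    using kr_is_bracket_sum_multiple[OF W(1), of h "\<lambda>_. h" "\<lambda>_. kr_w" 1]
    by (simp add: W numeral_2_eq_2)
  have "kr.is_bracket_sum 7 D" if D: "D \<in> kr_Vec" for D
  proof -
    obtain h where "D = (\<lambda>t. h * Y t) + (\<lambda>t. D kr_z * Z t) + (\<lambda>t. D kr_w * W t)"
      using basis[OF D] by blast
    moreover have "kr.is_bracket_sum (3 + 2 + 2)
        ((\<lambda>t. h * Y t) + (\<lambda>t. D kr_z * Z t) + (\<lambda>t. D kr_w * W t))"
      by (intro kr.is_bracket_sum_add multiple_Y multiple_Z multiple_W)
    ultimately show ?thesis
      by simp
  qed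
  then show ?thesis
    using kr.bracket_width_leI[of 7] by (simp add: numeral_eq_enat)
qed

end
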